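(* Let $M$ be a split matroid and let $\mathcal{X}=(X_1,X_2)$ and $\mathcal{Y}=(Y_1,Y_2)$ be two sequences of bases of $M$, each of length two. Then $\mathcal{X}$ and $\mathcal{Y}$ are equivalent if and only if they are compatible.
   Context: All matroids are on finite ground sets. For a set $X$ and elements $e,f$, write $X-e=X\setminus\{e\}$ and $X+f=X\cup\{f\}$; $X-Y$ denotes set difference. Symmetric exchange: let $(X_1,X_2)$ be an ordered pair of bases of a matroid $M$. If $e\in X_1-X_2$ and $f\in X_2-X_1$ are such that both $X_1-e+f$ and $X_2+e-f$ are bases of $M$, then the pair $(X_1-e+f,\,X_2+e-f)$ is said to be obtained from $(X_1,X_2)$ by a symmetric exchange. Two pairs $\mathcal{X}$ and $\mathcal{Y}$ are equivalent if $\mathcal{Y}$ may be obtained from $\mathcal{X}$ by a composition of (finitely many, possibly zero) symmetric exchanges. They are compatible if $|\{i\in\{1,2\}: s\in X_i\}|=|\{i\in\{1,2\}: s\in Y_i\}|$ for every element $s$ of the ground set. Elementary split matroid: let $S$ be a finite set, $r,r_1,\dots,r_q$ ($q\ge 0$) non-negative integers with $|S|\ge r$, and $H_1,\dots,H_q\subseteq S$ subsets such that $|H_i\cap H_j|\le r_i+r_j-r$ for all $1\le i<j\le q$, and $|S-H_i|+r_i\ge r$ for all $i$. Then $\{X\subseteq S : |X|\le r,\ |X\cap H_i|\le r_i \text{ for } 1\le i\le q\}$ is the family of independent sets of a rank-$r$ matroid on $S$; matroids arising this way are called elementary split matroids. Split matroid: a matroid is a split matroid if at most one of its connected components is a non-uniform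 matroid, and this component, if it exists, is an elementary split matroid (all other components being uniform matroids). *)

theory Defs
  imports Main
begin

text \<open>A matroid is given by its ground set \<open>E\<close> and its family \<open>\<I>\<close> of independent sets.\<close>

locale matroid =
  fixes E :: "'a set" and \<I> :: "'a set set"
  assumes finite_ground: "finite E"
    and indep_subset_ground: "X \<in> \<I> \<Longrightarrow> X \<subseteq> E"
    and indep_empty: "{} \<in> \<I>"
    and indep_hereditary: "X \<in> \<I> \<Longrightarrow> Y \<subseteq> X \<Longrightarrow> Y \<in> \<I>"
    and indep_augment:
      "X \<in> \<I> \<Longrightarrow> Y \<in> \<I> \<Longrightarrow> card X < card Y \<Longrightarrow> \<exists>e\<in>Y - X. insert e X \<in> \<I>"

definition is_basis :: "'a set set \<Rightarrow> 'a set \<Rightarrow> bool" where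
  "is_basis \<I> B \<longleftrightarrow> B \<in> \<I> \<and> (\<forall>X\<in>\<I>. B \<subseteq> X \<longrightarrow> X = B)"

definition restrict_indep :: "'a set set \<Rightarrow> 'a set \<Rightarrow> 'a set set" where
  "restrict_indep \<I> A = {X \<in> \<I>. X \<subseteq> A}"

definition direct_sum :: "'a set set \<Rightarrow> 'a set set \<Rightarrow> 'a set set" where
  "direct_sum \<I> \<J> = {X \<union> Y | X Y. X \<in> \<I> \<and> Y \<in> \<J>}"

text \<open>A decomposition of \<open>(E, \<I>)\<close> as a direct sum of matroids on \<open>A\<close> and \<open>E - A\<close> can only be
  the one into the restrictions to \<open>A\<close> and \<open>E - A\<close>.\<close>

definition direct_summand :: "'a set \<Rightarrow> 'a set set \<Rightarrow> 'a set \<Rightarrow> bool" where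
  "direct_summand E \<I> A \<longleftrightarrow>
     A \<subseteq> E \<and> \<I> = direct_sum (restrict_indep \<I> A) (restrict_indep \<I> (E - A))"

definition connected_matroid :: "'a set \<Rightarrow> 'a set set \<Rightarrow> bool" where
  "connected_matroid E \<I> \<longleftrightarrow> \<not> (\<exists>A. direct_summand E \<I> A \<and> A \<noteq> {} \<and> A \<noteq> E)"

text \<open>The ground sets of the connected components, that is, of the nonempty connected direct
  summands.\<close>

definition matroid_components :: "'a set \<Rightarrow> 'a set set \<Rightarrow> 'a set set" where
  "matroid_components E \<I> =
     {A. A \<noteq> {} \<and> direct_summand E \<I> A \<and> connected_matroid A (restrict_indep \<I> A)}"

definition uniform_matroid :: "'a set \<Rightarrow> 'a set set \<Rightarrow> bool" where
  "uniform_matroid E \<I> \<longleftrightarrow>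
     finite E \<and> (\<exists>k\<le>card E. \<I> = {X. X \<subseteq> E \<and> card X \<le> k})"

text \<open>The bound on \<open>card (H i \<inter> H j)\<close> is over the integers, since \<open>\<rho> i + \<rho> j - r\<close>
  may be negative (in which case the condition fails).\<close>

definition elementary_split_matroid :: "'a set \<Rightarrow> 'a set set \<Rightarrow> bool" where
  "elementary_split_matroid E \<I> \<longleftrightarrow>
     finite E \<and>
     (\<exists>(r::nat) (q::nat) (\<rho> :: nat \<Rightarrow> nat) (H :: nat \<Rightarrow> 'a set).
        r \<le> card E \<and>
        (\<forall>i\<in>{1..q}. H i \<subseteq> E) \<and>
        (\<forall>i\<in>{1..q}. \<forall>j\<in>{1..q}. i < j \<longrightarrow>
           int (card (H i \<inter> H j)) \<le> int (\<rho> i) + int (\<rho> j) - int r) \<and>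
        (\<forall>i\<in>{1..q}. r \<le> card (E - H i) + \<rho> i) \<and>
        \<I> = {X. X \<subseteq> E \<and> card X \<le> r \<and> (\<forall>i\<in>{1..q}. card (X \<inter> H i) \<le> \<rho> i)})"

definition split_matroid :: "'a set \<Rightarrow> 'a set set \<Rightarrow> bool" where
  "split_matroid E \<I> \<longleftrightarrow>
     matroid E \<I> \<and>
     (\<forall>A\<in>matroid_components E \<I>. \<forall>B\<in>matroid_components E \<I>.
        \<not> uniform_matroid A (restrict_indep \<I> A) \<longrightarrow>
        \<not> uniform_matroid B (restrict_indep \<I> B) \<longrightarrow> A = B) \<and>
     (\<forall>A\<in>matroid_components E \<I>.
        \<not> uniform_matroid A (restrict_indep \<I> A) \<longrightarrow>
        elementary_split_matroid A (restrict_indep \<I> A))"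

inductive symmetric_exchange ::
  "'a set set \<Rightarrow> 'a set \<times> 'a set \<Rightarrow> 'a set \<times> 'a set \<Rightarrow> bool" for \<I> where
  "\<lbrakk>is_basis \<I> X1; is_basis \<I> X2; e \<in> X1 - X2; f \<in> X2 - X1;
    is_basis \<I> ((X1 - {e}) \<union> {f}); is_basis \<I> ((X2 \<union> {e}) - {f})\<rbrakk> \<Longrightarrow>
   symmetric_exchange \<I> (X1, X2) ((X1 - {e}) \<union> {f}, (X2 \<union> {e}) - {f})"

definition equivalent_pairs ::
  "'a set set \<Rightarrow> 'a set \<times> 'a set \<Rightarrow> 'a set \<times> 'a set \<Rightarrow> bool" where
  "equivalent_pairs \<I> = (symmetric_exchange \<I>)\<^sup>*\<^sup>*"

text \<open>The sum of truth values below is the number of indices \<open>i \<in> {1, 2}\<close> with \<open>s \<in> X\<^sub>i\<close>.\<close>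

definition multiplicity_in_pair :: "'a set \<times> 'a set \<Rightarrow> 'a \<Rightarrow> nat" where
  "multiplicity_in_pair X s = of_bool (s \<in> fst X) + of_bool (s \<in> snd X)"

definition compatible_pairs ::
  "'a set \<Rightarrow> 'a set \<times> 'a set \<Rightarrow> 'a set \<times> 'a set \<Rightarrow> bool" where
  "compatible_pairs E X Y \<longleftrightarrow>
     (\<forall>s\<in>E. multiplicity_in_pair X s = multiplicity_in_pair Y s)"

end

theory Submission
  imports Defs
begin

text \<open>A symmetric exchange changes neither the union nor the intersection of a pair, and two pairs
  are compatible exactly if they share both; so equivalent pairs are compatible. For the converse,
  exchanges inside a direct summand are exchanges of the whole matroid, hence it suffices to treat
  the connected components one at a time, and each of these is elementary split (a uniform matroid
  is one with no sets \<open>H i\<close>).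

  Let \<open>(X1, X2)\<close> and \<open>(Y1, Y2)\<close> be compatible pairs of bases of an elementary split matroid, and put
  \<open>D = X1 - Y1 = Y2 - X2\<close> and \<open>D' = X2 - Y2 = Y1 - X1\<close>. Exchanging \<open>x \<in> D\<close> with \<open>y \<in> D'\<close> makes \<open>D\<close>
  smaller; it fails only if it overfills some \<open>H i\<close> that is tight, that is, meets \<open>X1\<close> (or \<open>X2\<close>) in
  exactly \<open>\<rho> i\<close> elements. The bound on \<open>card (H i \<inter> H j)\<close> is what makes tight sets so rigid: two
  sets tight at a basis \<open>X\<close> cover \<open>X\<close> and intersect inside \<open>X\<close>. From this it follows that if all
  exchanges between \<open>D\<close> and \<open>D'\<close> fail, then there are sets \<open>u1, u2\<close> tight at \<open>X1\<close> and \<open>l1, l2\<close> tight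
  at \<open>X2\<close>, together with four elements that lie in exactly two of these sets: in \<open>D\<close>, one of type
  \<open>u1, l2\<close> and one of type \<open>u2, l1\<close>; in \<open>D'\<close>, one of type \<open>u1, l1\<close> and one of type \<open>u2, l2\<close>
  (\<open>stuck_configuration\<close>).

  In this case progress requires a detour. Adding the overlap bounds of the four pairs
  \<open>(u\<^sub>a, l\<^sub>b)\<close>, and comparing with the two overlaps \<open>u1 \<inter> u2\<close> and \<open>l1 \<inter> l2\<close>, whose sizes are
  known exactly, shows that there is an element \<open>z\<close> in \<open>u1 \<inter> u2\<close> outside \<open>l1 \<union> l2\<close>, or the other
  way round (\<open>detour_element\<close>). Say the former. Exchanging \<open>z\<close> with the element of \<open>D'\<close> of type
  \<open>u1, l1\<close> does not overfill \<open>u1\<close> and frees a place in \<open>l1\<close>, after which the element of type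
  \<open>u2, l1\<close> of \<open>D\<close> can be exchanged with the one of type \<open>u2, l2\<close> of \<open>D'\<close> (\<open>detour\<close>). The two
  exchanges together bring the pair closer to \<open>(Y1, Y2)\<close>, and induction on \<open>card (X1 - Y1)\<close>
  finishes the proof.\<close>

section \<open>Compatible pairs and symmetric exchanges\<close>

lemma compatible_pairs_iff_same_union_and_intersection:
  assumes "X1 \<subseteq> E" "X2 \<subseteq> E" "Y1 \<subseteq> E" "Y2 \<subseteq> E"
  shows "compatible_pairs E (X1, X2) (Y1, Y2) \<longleftrightarrow> X1 \<union> X2 = Y1 \<union> Y2 \<and> X1 \<inter> X2 = Y1 \<inter> Y2"
proof -
  have "multiplicity_in_pair (X1, X2) s = multiplicity_in_pair (Y1, Y2) s \<longleftrightarrow>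
     (s \<in> X1 \<union> X2 \<longleftrightarrow> s \<in> Y1 \<union> Y2) \<and> (s \<in> X1 \<inter> X2 \<longleftrightarrow> s \<in> Y1 \<inter> Y2)" for s
    by (auto simp: multiplicity_in_pair_def of_bool_def)
  then show ?thesis
    using assms unfolding compatible_pairs_def by blast
qed

lemma symmetric_exchangeI:
  assumes "is_basis \<I> X1" "is_basis \<I> X2" "e \<in> X1 - X2" "f \<in> X2 - X1"
    "is_basis \<I> (X1 - {e} \<union> {f})" "is_basis \<I> (X2 - {f} \<union> {e})"
  shows "symmetric_exchange \<I> (X1, X2) (X1 - {e} \<union> {f}, X2 - {f} \<union> {e})"
proof -
  have eq: "X2 - {f} \<union> {e} = (X2 \<union> {e}) - {f}"
    using assms(3,4) by auto
  show ?thesis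
    unfolding eq using assms(1-5) assms(6)[unfolded eq] by (rule symmetric_exchange.intros)
qed

lemma symmetric_exchangeE:
  assumes "symmetric_exchange \<I> (X1, X2) Q"
  obtains e f where "is_basis \<I> X1" "is_basis \<I> X2" "e \<in> X1 - X2" "f \<in> X2 - X1"
    "is_basis \<I> (X1 - {e} \<union> {f})" "is_basis \<I> (X2 - {f} \<union> {e})"
    "Q = (X1 - {e} \<union> {f}, X2 - {f} \<union> {e})"
  using assms
proof (cases rule: symmetric_exchange.cases)
  case (1 e f)
  have eq: "(X2 \<union> {e}) - {f} = X2 - {f} \<union> {e}"
    using 1 by auto
  show thesis
    using that[of e f] 1 unfolding eq by blast
qed

lemma equivalent_pairs_same_union_and_intersection:
  assumes "equivalent_pairs \<I> P Q"
  shows "fst P \<union> snd P = fst Q \<union> snd Q \<and> fst P \<inter> snd P = fst Q \<inter> snd Q"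
  using assms unfolding equivalent_pairs_def
proof (induction rule: rtranclp_induct)
  case (step Q R)
  obtain Q1 Q2 where "Q = (Q1, Q2)" by (cases Q)
  moreover from step.hyps(2) this have
    "fst Q \<union> snd Q = fst R \<union> snd R \<and> fst Q \<inter> snd Q = fst R \<inter> snd R"
    by (auto elim!: symmetric_exchangeE)
  ultimately show ?case using step.IH by simp
qed simp

lemma equivalent_pairs_bases:
  assumes "equivalent_pairs \<I> P Q" "is_basis \<I> (fst P)" "is_basis \<I> (snd P)"
  shows "is_basis \<I> (fst Q) \<and> is_basis \<I> (snd Q)"
  using assms unfolding equivalent_pairs_def
  by (induction rule: rtranclp_induct) (auto elim: symmetric_exchange.cases)

lemma equivalent_pairs_swap:
  assumes "equivalent_pairs \<I> P Q"
  shows "equivalent_pairs \<I> (prod.swap P) (prod.swap Q)"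
  using assms unfolding equivalent_pairs_def
proof (induction rule: rtranclp_induct)
  case (step Q R)
  obtain Q1 Q2 where Q: "Q = (Q1, Q2)" by (cases Q)
  have "symmetric_exchange \<I> (prod.swap Q) (prod.swap R)"
    using step.hyps(2) unfolding Q
    by (rule symmetric_exchangeE) (simp only: swap_simp, rule symmetric_exchangeI)
  then show ?case using step.IH by simp
qed simp

section \<open>Elementary split matroids\<close>

locale elementary_split_presentation =
  fixes E :: "'a set" and \<I> :: "'a set set" and r :: nat and N :: "'b set"
    and \<rho> :: "'b \<Rightarrow> nat" and H :: "'b \<Rightarrow> 'a set"
  assumes finite_ground: "finite E"
    and rank_le: "r \<le> card E"
    and H_subset: "i \<in> N \<Longrightarrow> H i \<subseteq> E"
    and overlap: "i \<in> N \<Longrightarrow> j \<in> N \<Longrightarrow> i \<noteq> j \<Longrightarrow> card (H i \<inter> H j) + r \<le> \<rho> i + \<rho> j"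
    and rank_le_outside: "i \<in> N \<Longrightarrow> r \<le> card (E - H i) + \<rho> i"
    and indep_iff: "X \<in> \<I> \<longleftrightarrow> X \<subseteq> E \<and> card X \<le> r \<and> (\<forall>i\<in>N. card (X \<inter> H i) \<le> \<rho> i)"
begin

definition tight :: "'a set \<Rightarrow> 'b \<Rightarrow> bool" where
  "tight X i \<longleftrightarrow> i \<in> N \<and> card (X \<inter> H i) = \<rho> i"

text \<open>Two tight sets would together hold \<open>\<rho> i + \<rho> j\<close> elements of \<open>X\<close>, of which only
  \<open>\<rho> i + \<rho> j - r\<close> can be counted twice.\<close>

lemma tight_pair_rank_le:
  assumes "finite X" "tight X i" "tight X j" "i \<noteq> j"
  shows "r \<le> card X"
proof -
  have ij: "i \<in> N" "j \<in> N" "card (X \<inter> H i) = \<rho> i" "card (X \<inter> H j) = \<rho> j"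
    using assms by (auto simp: tight_def)
  have fin: "finite (H i)" "finite (H j)"
    using ij H_subset finite_ground finite_subset by metis+
  have "\<rho> i + \<rho> j = card (X \<inter> H i \<union> X \<inter> H j) + card ((X \<inter> H i) \<inter> (X \<inter> H j))"
    using ij assms(1) by (metis card_Un_Int finite_Int)
  moreover have "card (X \<inter> H i \<union> X \<inter> H j) \<le> card X"
    by (rule card_mono) (use assms in auto)
  moreover have "card ((X \<inter> H i) \<inter> (X \<inter> H j)) \<le> card (H i \<inter> H j)"
    by (rule card_mono) (use fin in auto)
  ultimately show ?thesis
    using overlap[OF ij(1,2) assms(4)] by linarith
qed

text \<open>The parameter \<open>r\<close> really is the rank. If a maximal independent \<open>X\<close> had fewer than \<open>r\<close>
  elements, then at most one set would be tight at \<open>X\<close>; being the only obstacle to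
  enlarging \<open>X\<close>, it contains \<open>E - X\<close>, and then \<open>rank_le_outside\<close> gives \<open>X\<close> at least
  \<open>r\<close> elements after all.\<close>

lemma basis_iff: "is_basis \<I> X \<longleftrightarrow> X \<subseteq> E \<and> card X = r \<and> (\<forall>i\<in>N. card (X \<inter> H i) \<le> \<rho> i)"
proof
  assume basis: "is_basis \<I> X"
  then have X: "X \<subseteq> E" "card X \<le> r" "\<forall>i\<in>N. card (X \<inter> H i) \<le> \<rho> i"
    using indep_iff by (auto simp: is_basis_def)
  have fin: "finite X" using X(1) finite_ground finite_subset by blast
  have "r \<le> card X"
  proof (rule ccontr)
    assume small: "\<not> r \<le> card X"
    have blocked: "\<exists>i. tight X i \<and> s \<in> H i" if "s \<in> E - X" for s
    proof (rule ccontr)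
      assume no: "\<nexists>i. tight X i \<and> s \<in> H i"
      have "card (insert s X \<inter> H i) \<le> \<rho> i" if i: "i \<in> N" for i
      proof (cases "s \<in> H i")
        case True
        then have "card (X \<inter> H i) < \<rho> i"
          using no X(3) i unfolding tight_def by (metis le_neq_implies_less)
        then show ?thesis
          using True \<open>s \<in> E - X\<close> fin by simp
      qed (use X(3) i in simp)
      then have "insert s X \<in> \<I>"
        using indep_iff X(1) small that fin by auto
      then show False
        using basis that unfolding is_basis_def by blast
    qed
    obtain s where s: "s \<in> E - X"
      using small rank_le X(1) by (metis Diff_eq_empty_iff ex_in_conv subset_antisym)
    obtain i where i: "tight X i" using blocked[OF s] by blast
    have "E - X \<subseteq> H i"
      using blocked tight_pair_rank_le[OF fin i] small by blast
    then have "X = (E - H i) \<union> (X \<inter> H i)" using X(1) by blast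
    moreover have "card ((E - H i) \<union> (X \<inter> H i)) = card (E - H i) + card (X \<inter> H i)"
      by (rule card_Un_disjoint) (use fin finite_ground in auto)
    ultimately have "card X = card (E - H i) + \<rho> i"
      using i by (simp add: tight_def)
    then show False using rank_le_outside[of i] i small by (simp add: tight_def)
  qed
  then show "X \<subseteq> E \<and> card X = r \<and> (\<forall>i\<in>N. card (X \<inter> H i) \<le> \<rho> i)"
    using X by simp
next
  assume X: "X \<subseteq> E \<and> card X = r \<and> (\<forall>i\<in>N. card (X \<inter> H i) \<le> \<rho> i)"
  have "Y = X" if "Y \<in> \<I>" "X \<subseteq> Y" for Y
  proof -
    have "Y \<subseteq> E" "card Y \<le> card X" using that(1) X indep_iff by auto
    then show ?thesis
      using card_seteq[OF _ that(2)] finite_ground finite_subset by metis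
  qed
  then show "is_basis \<I> X"
    using X indep_iff unfolding is_basis_def by auto
qed

lemma
  assumes "is_basis \<I> X"
  shows basis_subset: "X \<subseteq> E" and basis_card: "card X = r" and basis_finite: "finite X"
    and basis_bound: "i \<in> N \<Longrightarrow> card (X \<inter> H i) \<le> \<rho> i"
proof -
  show *: "X \<subseteq> E" "card X = r" "i \<in> N \<Longrightarrow> card (X \<inter> H i) \<le> \<rho> i"
    using assms by (simp_all add: basis_iff)
  show "finite X" using finite_ground *(1) by (rule rev_finite_subset)
qed

text \<open>Stated with sums on both sides to avoid subtraction on the natural numbers; \<open>A = UNIV\<close> gives
  the cardinality of the exchanged set itself.\<close>

lemma card_Int_exchange:
  assumes "finite X" "e \<in> X" "f \<notin> X"
  shows "card ((X - {e} \<union> {f}) \<inter> A) + of_bool (e \<in> A) = card (X \<inter> A) + of_bool (f \<in> A)"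
proof -
  have 1: "card ((X - {e}) \<inter> A) + of_bool (e \<in> A) = card (X \<inter> A)"
  proof (cases "e \<in> A")
    case True
    then have "(X - {e}) \<inter> A = (X \<inter> A) - {e}" by blast
    then show ?thesis using True assms card_Suc_Diff1[of "X \<inter> A" e] by simp
  next
    case False
    then have "(X - {e}) \<inter> A = X \<inter> A" by blast
    then show ?thesis using False by simp
  qed
  have 2: "card ((X - {e} \<union> {f}) \<inter> A) = card ((X - {e}) \<inter> A) + of_bool (f \<in> A)"
    using assms by (cases "f \<in> A") auto
  show ?thesis using 1 2 by linarith
qed

lemma basis_exchange:
  assumes "is_basis \<I> X" "e \<in> X" "f \<in> E - X"
    and "\<And>i. tight X i \<Longrightarrow> f \<in> H i \<Longrightarrow> e \<in> H i"
  shows "is_basis \<I> (X - {e} \<union> {f})"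
proof -
  note X = basis_subset[OF assms(1)] basis_card[OF assms(1)] basis_bound[OF assms(1)]
  have fin: "finite X" using assms(1) by (rule basis_finite)
  note change = card_Int_exchange[OF fin assms(2), of f]
  have "card (X - {e} \<union> {f}) = r"
    using change[of UNIV] assms(3) X(2) by simp
  moreover have "card ((X - {e} \<union> {f}) \<inter> H i) \<le> \<rho> i" if i: "i \<in> N" for i
  proof (cases "f \<in> H i \<and> e \<notin> H i")
    case True
    then have "card (X \<inter> H i) < \<rho> i"
      using assms(4)[of i] X(3) i unfolding tight_def by (metis le_neq_implies_less)
    then show ?thesis using change[of "H i"] assms(3) True by simp
  next
    case False
    then show ?thesis using change[of "H i"] assms(3) X(3)[OF i]
      by (auto simp: of_bool_def split: if_splits)
  qed
  ultimately show ?thesis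
    using X(1) assms(3) by (simp add: basis_iff) blast
qed

text \<open>The count behind \<open>tight_pair_rank_le\<close>, now applied to a set with exactly \<open>r\<close> elements:
  every inequality in it must be an equality.\<close>

lemma tight_pair_of_basis:
  assumes "is_basis \<I> X" "tight X i" "tight X j" "i \<noteq> j"
  shows "X \<subseteq> H i \<union> H j" "H i \<inter> H j \<subseteq> X" "card (H i \<inter> H j) + r = \<rho> i + \<rho> j"
proof -
  have X: "finite X" "card X = r"
    using basis_finite[OF assms(1)] basis_card[OF assms(1)] by auto
  have ij: "i \<in> N" "j \<in> N" "card (X \<inter> H i) = \<rho> i" "card (X \<inter> H j) = \<rho> j"
    using assms by (auto simp: tight_def)
  have fin: "finite (H i)" "finite (H j)"
    using ij H_subset finite_ground finite_subset by metis+
  have count: "\<rho> i + \<rho> j = card (X \<inter> (H i \<union> H j)) + card (X \<inter> (H i \<inter> H j))"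
    using card_Un_Int[of "X \<inter> H i" "X \<inter> H j"] ij X
    by (simp add: Int_Un_distrib Int_ac)
  have le1: "card (X \<inter> (H i \<union> H j)) \<le> card X"
    by (rule card_mono) (use X in auto)
  have le2: "card (X \<inter> (H i \<inter> H j)) \<le> card (H i \<inter> H j)"
    by (rule card_mono) (use fin in auto)
  note ov = overlap[OF ij(1,2) assms(4)]
  have "X \<inter> (H i \<union> H j) = X"
    by (rule card_seteq) (use X count le1 le2 ov in auto)
  then show "X \<subseteq> H i \<union> H j" by blast
  have "X \<inter> (H i \<inter> H j) = H i \<inter> H j"
    by (rule card_seteq) (use fin X count le1 le2 ov in auto)
  then show "H i \<inter> H j \<subseteq> X" by blast
  show "card (H i \<inter> H j) + r = \<rho> i + \<rho> j"
    using count le1 le2 ov X by linarith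
qed

text \<open>The count still works with one unit of slack, because the element \<open>f\<close> of the overlap outside
  \<open>X\<close> pays for it. This handles the sets that become tight only after the first step
  of a detour.\<close>

lemma nearly_tight_pair_covers_basis:
  assumes "is_basis \<I> X" "i \<in> N" "card (X \<inter> H i) + 1 = \<rho> i" "tight X j" "i \<noteq> j"
    and f: "f \<in> H i \<inter> H j" "f \<notin> X"
  shows "X \<subseteq> H i \<union> H j"
proof -
  have X: "finite X" "card X = r"
    using basis_finite[OF assms(1)] basis_card[OF assms(1)] by auto
  have j: "j \<in> N" "card (X \<inter> H j) = \<rho> j"
    using assms by (auto simp: tight_def)
  have fin: "finite (H i)"
    using assms(2) H_subset finite_ground finite_subset by metis
  have count: "card (X \<inter> H i) + card (X \<inter> H j) = card (X \<inter> (H i \<union> H j)) + card (X \<inter> (H i \<inter> H j))"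
    using card_Un_Int[of "X \<inter> H i" "X \<inter> H j"] X
    by (simp add: Int_Un_distrib Int_ac)
  have "card (X \<inter> (H i \<inter> H j)) < card (H i \<inter> H j)"
    by (rule psubset_card_mono) (use fin f in auto)
  then have "r \<le> card (X \<inter> (H i \<union> H j))"
    using count overlap[OF assms(2) j(1) assms(5)] assms(3) j(2) by linarith
  then have "X \<inter> (H i \<union> H j) = X"
    by (intro card_seteq) (use X in auto)
  then show ?thesis by blast
qed

end

section \<open>Stuck pairs of bases\<close>

text \<open>The analysis of stuck pairs only needs the traces of the tight sets on \<open>D\<close> and \<open>D'\<close>. Below,
  \<open>T1\<close> and \<open>T2\<close> index the sets that are tight at the first and at the second basis; an exchange of
  \<open>x \<in> D\<close> with \<open>y \<in> D'\<close> is blocked by a set of \<open>T1\<close> containing \<open>y\<close> but not \<open>x\<close>, or by a set of \<open>T2\<close>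
  containing \<open>x\<close> but not \<open>y\<close>. The hypotheses are symmetric under exchanging \<open>D, T1\<close> with \<open>D', T2\<close>.\<close>

text \<open>If no set of \<open>T1\<close> contained \<open>y\<close>, then \<open>y\<close> would be blocked against every element of \<open>D\<close> by
  sets of \<open>T2\<close>, in fact always by the same one, since two of them would cover \<open>y\<close>. The
  \<open>T2\<close>-set so found meets \<open>D'\<close> in some \<open>y'\<close>, and \<open>y'\<close> can then be exchanged with an element of
  \<open>D\<close> in the \<open>T1\<close>-set that contains \<open>y'\<close>.\<close>

lemma stuck_covered:
  fixes H :: "'b \<Rightarrow> 'a set"
  assumes ne: "D \<noteq> {}"
    and hit1: "\<And>i. i \<in> T1 \<Longrightarrow> D' \<inter> H i \<noteq> {} \<Longrightarrow> D \<inter> H i \<noteq> {}"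
    and hit2: "\<And>i. i \<in> T2 \<Longrightarrow> D \<inter> H i \<noteq> {} \<Longrightarrow> D' \<inter> H i \<noteq> {}"
    and disj1: "\<And>i j. i \<in> T1 \<Longrightarrow> j \<in> T1 \<Longrightarrow> i \<noteq> j \<Longrightarrow> D' \<inter> H i \<inter> H j = {}"
    and disj2: "\<And>i j. i \<in> T2 \<Longrightarrow> j \<in> T2 \<Longrightarrow> i \<noteq> j \<Longrightarrow> D \<inter> H i \<inter> H j = {}"
    and cov2: "\<And>i j. i \<in> T2 \<Longrightarrow> j \<in> T2 \<Longrightarrow> i \<noteq> j \<Longrightarrow> D' \<subseteq> H i \<union> H j"
    and stuck: "\<And>x y. x \<in> D \<Longrightarrow> y \<in> D' \<Longrightarrow>
      (\<exists>i\<in>T1. y \<in> H i \<and> x \<notin> H i) \<or> (\<exists>i\<in>T2. x \<in> H i \<and> y \<notin> H i)"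
    and y: "y \<in> D'"
  shows "\<exists>i\<in>T1. y \<in> H i"
proof (rule ccontr)
  assume no: "\<not> (\<exists>i\<in>T1. y \<in> H i)"
  obtain x where x: "x \<in> D" using ne by blast
  obtain i where i: "i \<in> T2" "x \<in> H i" "y \<notin> H i" using stuck[OF x y] no by blast
  obtain y' where y': "y' \<in> D'" "y' \<in> H i" using hit2[OF i(1)] x i(2) by blast
  obtain k where k: "k \<in> T1" "y' \<in> H k" "x \<notin> H k"
    using stuck[OF x y'(1)] disj2[OF i(1)] x i(2) y'(2) by blast
  obtain x' where x': "x' \<in> D" "x' \<in> H k" using hit1[OF k(1)] y' k by blast
  obtain j where j: "j \<in> T2" "x' \<in> H j" "y \<notin> H j" using stuck[OF x'(1) y] no by blast
  have "j = i" using cov2[OF i(1) j(1)] y i(3) j(3) by blast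
  then have x'i: "x' \<in> H i" using j by simp
  have "m = k" if "m \<in> T1" "y' \<in> H m" for m using disj1[OF that(1) k(1)] that(2) k(2) y'(1) by blast
  moreover have "m = i" if "m \<in> T2" "x' \<in> H m" for m
    using disj2[OF that(1) i(1)] that(2) x'i x'(1) by blast
  ultimately show False
    using stuck[OF x'(1) y'(1)] x'(2) y'(2) by blast
qed

text \<open>By \<open>stuck_covered\<close> and its mirror image every element of \<open>D\<close> and \<open>D'\<close> lies in exactly one of
  the sets that could block it. No single \<open>u \<in> T1\<close> contains \<open>D'\<close>: by cardinality it would contain \<open>D\<close>
  too, and block nothing. Hence there are two relevant sets on each side, and the covering
  and disjointness conditions determine the remaining memberships.\<close>

lemma stuck_configuration:
  fixes H :: "'b \<Rightarrow> 'a set"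
  assumes fin: "finite D" "finite D'" and card_eq: "card D = card D'" and ne: "D \<noteq> {}"
    and le1: "\<And>i. i \<in> T1 \<Longrightarrow> card (D' \<inter> H i) \<le> card (D \<inter> H i)"
    and le2: "\<And>i. i \<in> T2 \<Longrightarrow> card (D \<inter> H i) \<le> card (D' \<inter> H i)"
    and disj1: "\<And>i j. i \<in> T1 \<Longrightarrow> j \<in> T1 \<Longrightarrow> i \<noteq> j \<Longrightarrow> D' \<inter> H i \<inter> H j = {}"
    and disj2: "\<And>i j. i \<in> T2 \<Longrightarrow> j \<in> T2 \<Longrightarrow> i \<noteq> j \<Longrightarrow> D \<inter> H i \<inter> H j = {}"
    and cov1: "\<And>i j. i \<in> T1 \<Longrightarrow> j \<in> T1 \<Longrightarrow> i \<noteq> j \<Longrightarrow> D \<subseteq> H i \<union> H j"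
    and cov2: "\<And>i j. i \<in> T2 \<Longrightarrow> j \<in> T2 \<Longrightarrow> i \<noteq> j \<Longrightarrow> D' \<subseteq> H i \<union> H j"
    and stuck: "\<And>x y. x \<in> D \<Longrightarrow> y \<in> D' \<Longrightarrow>
      (\<exists>i\<in>T1. y \<in> H i \<and> x \<notin> H i) \<or> (\<exists>i\<in>T2. x \<in> H i \<and> y \<notin> H i)"
  obtains u1 u2 l1 l2 x1 x2 y1 y2 where
    "u1 \<in> T1" "u2 \<in> T1" "l1 \<in> T2" "l2 \<in> T2"
    "x1 \<in> D" "x1 \<in> H u1 - H u2" "x1 \<in> H l2 - H l1"
    "x2 \<in> D" "x2 \<in> H u2 - H u1" "x2 \<in> H l1 - H l2"
    "y1 \<in> D'" "y1 \<in> H u1 - H u2" "y1 \<in> H l1 - H l2"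
    "y2 \<in> D'" "y2 \<in> H u2 - H u1" "y2 \<in> H l2 - H l1"
proof -
  have hit1: "D \<inter> H i \<noteq> {}" if "i \<in> T1" "D' \<inter> H i \<noteq> {}" for i
    using le1[OF that(1)] that(2) fin by (metis card_0_eq finite_Int le_zero_eq)
  have hit2: "D' \<inter> H i \<noteq> {}" if "i \<in> T2" "D \<inter> H i \<noteq> {}" for i
    using le2[OF that(1)] that(2) fin by (metis card_0_eq finite_Int le_zero_eq)
  have ne': "D' \<noteq> {}" using ne card_eq fin by auto
  have in1: "\<exists>i\<in>T1. y \<in> H i" if "y \<in> D'" for y
    using stuck_covered[OF ne hit1 hit2 disj1 disj2 cov2 stuck that] .
  have stuck': "(\<exists>i\<in>T2. x \<in> H i \<and> y \<notin> H i) \<or> (\<exists>i\<in>T1. y \<in> H i \<and> x \<notin> H i)"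
    if "y \<in> D'" "x \<in> D" for x y
    using stuck[OF that(2,1)] by (rule disj_commute[THEN iffD1])
  have in2: "\<exists>i\<in>T2. x \<in> H i" if "x \<in> D" for x
    using stuck_covered[OF ne' hit2 hit1 disj2 disj1 cov1 stuck' that] .
  have uniq1: "i = j" if "i \<in> T1" "j \<in> T1" "y \<in> D'" "y \<in> H i" "y \<in> H j" for i j y
    using disj1 that by blast
  have uniq2: "i = j" if "i \<in> T2" "j \<in> T2" "x \<in> D" "x \<in> H i" "x \<in> H j" for i j x
    using disj2 that by blast
  \<comment> \<open>An exchange inside a \<open>T2\<close>-set can be blocked only by a \<open>T1\<close>-set, since the elements of \<open>D\<close>
    lie in just one \<open>T2\<close>-set. This yields \<open>x2, y1, l1, u1\<close>, and the same argument
    inside \<open>u1\<close> yields \<open>x1\<close> and \<open>l2\<close>.\<close>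
  obtain x2 where x2: "x2 \<in> D" using ne by blast
  obtain l1 where l1: "l1 \<in> T2" "x2 \<in> H l1" using in2[OF x2] by blast
  obtain y1 where y1: "y1 \<in> D'" "y1 \<in> H l1" using hit2[OF l1(1)] l1 x2 by blast
  obtain u1 where u1: "u1 \<in> T1" "y1 \<in> H u1" "x2 \<notin> H u1"
    using stuck[OF x2 y1(1)] uniq2[OF _ l1(1) x2 _ l1(2)] y1 by blast
  have "\<not> D' \<subseteq> H u1"
  proof
    assume "D' \<subseteq> H u1"
    then have "card D \<le> card (D \<inter> H u1)"
      using le1[OF u1(1)] card_eq by (simp add: Int_absorb2)
    then have "D \<inter> H u1 = D" by (intro card_seteq) (use fin in auto)
    then show False using x2 u1 by blast
  qed
  then obtain y2 where y2: "y2 \<in> D'" "y2 \<notin> H u1" by blast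
  obtain u2 where u2: "u2 \<in> T1" "y2 \<in> H u2" using in1[OF y2(1)] by blast
  have u12: "u1 \<noteq> u2" using y2 u2 by blast
  have x2u2: "x2 \<in> H u2" using cov1[OF u1(1) u2(1) u12] x2 u1 by blast
  have y2l1: "y2 \<notin> H l1"
    using stuck[OF x2 y2(1)] uniq1[OF _ u2(1) y2(1) _ u2(2)] uniq2[OF _ l1(1) x2 _ l1(2)] x2u2 by blast
  obtain x1 where x1: "x1 \<in> D" "x1 \<in> H u1" using hit1[OF u1(1)] y1 u1 by blast
  obtain l2 where l2: "l2 \<in> T2" "x1 \<in> H l2" "y1 \<notin> H l2"
    using stuck[OF x1(1) y1(1)] uniq1[OF _ u1(1) y1(1) _ u1(2)] x1 by blast
  have l12: "l1 \<noteq> l2" using l2 y1 by blast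
  have y2l2: "y2 \<in> H l2" using cov2[OF l1(1) l2(1) l12] y2 y2l1 by blast
  have x1u2: "x1 \<notin> H u2"
    using stuck[OF x1(1) y2(1)] uniq2[OF _ l2(1) x1(1) _ l2(2)] uniq1[OF _ u2(1) y2(1) _ u2(2)] y2l2 by blast
  have "x1 \<notin> H l1" using uniq2[OF l1(1) l2(1) x1(1)] l2 l12 by blast
  moreover have "x2 \<notin> H l2" using uniq2[OF l1(1) l2(1) x2] l1 l12 by blast
  moreover have "y1 \<notin> H u2" using uniq1[OF u1(1) u2(1) y1(1)] u1 u12 by blast
  ultimately show thesis
    using that[of u1 u2 l1 l2 x1 x2 y1 y2] u1 u2 l1 l2 x1 x2 y1 y2 x2u2 y2l1 y2l2 x1u2 by blast
qed

text \<open>Pointwise: an element in \<open>a\<close> of the sets \<open>A1, A2\<close> and in \<open>b\<close> of the sets \<open>B1, B2\<close> is counted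
  \<open>a * b\<close> times on the right. On the left it is counted twice if \<open>a = 2\<close> and twice if \<open>b = 2\<close>,
  which is at most \<open>a * b\<close> because \<open>a = 2\<close> forces \<open>b \<ge> 1\<close> and conversely. The element \<open>x\<close>
  has \<open>a = b = 1\<close> and makes the inequality strict.\<close>

lemma card_crossing_lower_bound:
  assumes "finite A1" "finite A2" "finite B1" "finite B2"
    and "A1 \<inter> A2 \<subseteq> B1 \<union> B2" "B1 \<inter> B2 \<subseteq> A1 \<union> A2"
    and x: "x \<in> A1 - A2" "x \<in> B2 - B1"
  shows "2 * card (A1 \<inter> A2) + 2 * card (B1 \<inter> B2)
    < card (A1 \<inter> B1) + card (A1 \<inter> B2) + card (A2 \<inter> B1) + card (A2 \<inter> B2)"
proof -
  define S where "S = A1 \<union> A2 \<union> B1 \<union> B2"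
  have fin: "finite S" using assms by (simp add: S_def)
  have c: "card A = (\<Sum>s\<in>S. of_bool (s \<in> A))" if "A \<subseteq> S" for A
    using that fin by (simp add: Int_absorb1)
  have "(\<Sum>s\<in>S. 2 * of_bool (s \<in> A1 \<inter> A2) + 2 * of_bool (s \<in> B1 \<inter> B2) :: nat)
    < (\<Sum>s\<in>S. of_bool (s \<in> A1 \<inter> B1) + of_bool (s \<in> A1 \<inter> B2) + of_bool (s \<in> A2 \<inter> B1) + of_bool (s \<in> A2 \<inter> B2))"
  proof (rule sum_strict_mono_ex1[OF fin])
    show "\<forall>s\<in>S. 2 * of_bool (s \<in> A1 \<inter> A2) + 2 * of_bool (s \<in> B1 \<inter> B2) \<le>
       (of_bool (s \<in> A1 \<inter> B1) + of_bool (s \<in> A1 \<inter> B2) + of_bool (s \<in> A2 \<inter> B1) + of_bool (s \<in> A2 \<inter> B2) :: nat)"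
      using assms(5,6) by (auto simp: of_bool_def)
    show "\<exists>s\<in>S. 2 * of_bool (s \<in> A1 \<inter> A2) + 2 * of_bool (s \<in> B1 \<inter> B2) <
       (of_bool (s \<in> A1 \<inter> B1) + of_bool (s \<in> A1 \<inter> B2) + of_bool (s \<in> A2 \<inter> B1) + of_bool (s \<in> A2 \<inter> B2) :: nat)"
      by (rule bexI[of _ x]) (use x in \<open>auto simp: S_def\<close>)
  qed
  moreover have "A1 \<inter> A2 \<subseteq> S" "B1 \<inter> B2 \<subseteq> S" "A1 \<inter> B1 \<subseteq> S" "A1 \<inter> B2 \<subseteq> S" "A2 \<inter> B1 \<subseteq> S" "A2 \<inter> B2 \<subseteq> S"
    by (auto simp: S_def)
  ultimately show ?thesis
    by (simp only: c sum.distrib sum_distrib_left)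
qed

context elementary_split_presentation
begin

lemma exchange_pair:
  assumes X: "is_basis \<I> X1" "is_basis \<I> X2"
    and e: "e \<in> X1 - X2" and f: "f \<in> X2 - X1"
    and u: "\<And>i. tight X1 i \<Longrightarrow> f \<in> H i \<Longrightarrow> e \<in> H i"
    and l: "\<And>i. tight X2 i \<Longrightarrow> e \<in> H i \<Longrightarrow> f \<in> H i"
  shows "symmetric_exchange \<I> (X1, X2) (X1 - {e} \<union> {f}, X2 - {f} \<union> {e})"
proof (rule symmetric_exchangeI)
  have "X1 \<subseteq> E" "X2 \<subseteq> E" using X basis_subset by blast+
  then have "e \<in> X1" "f \<in> E - X1" "f \<in> X2" "e \<in> E - X2" using e f by blast+
  then show "is_basis \<I> (X1 - {e} \<union> {f})" "is_basis \<I> (X2 - {f} \<union> {e})"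
    using basis_exchange[OF X(1) _ _ u] basis_exchange[OF X(2) _ _ l] by blast+
qed (use assms in auto)

text \<open>The only tight set that blocks the exchange of \<open>x\<close> with \<open>y2\<close> is \<open>l1\<close>, and it loses \<open>y1\<close> without
  receiving \<open>z\<close> when these two are exchanged first. That first exchange is possible because
  \<open>u1\<close>, the only set tight at \<open>X1\<close> that contains \<open>y1\<close>, also contains \<open>z\<close>, and because a set tight at \<open>X2\<close>
  that contains \<open>z\<close> differs from \<open>l2\<close> and so covers, together with it, the element \<open>y1\<close>. The second
  exchange could then be hindered only by a set that has just become tight, and
  \<open>nearly_tight_pair_covers_basis\<close> excludes this.\<close>

lemma detour:
  assumes X: "is_basis \<I> X1" "is_basis \<I> X2"
    and u: "tight X1 u1" "tight X1 u2" and l: "tight X2 l1" "tight X2 l2"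
    and x: "x \<in> X1 - X2" "x \<in> H u2 - H u1" "x \<in> H l1 - H l2"
    and y1: "y1 \<in> X2 - X1" "y1 \<in> H u1 - H u2" "y1 \<in> H l1 - H l2"
    and y2: "y2 \<in> X2 - X1" "y2 \<in> H u2 - H u1" "y2 \<in> H l2 - H l1"
    and z: "z \<in> H u1 \<inter> H u2" "z \<notin> H l1 \<union> H l2"
  shows "equivalent_pairs \<I> (X1, X2)
    ((X1 - {z} \<union> {y1}) - {x} \<union> {y2}, (X2 - {y1} \<union> {z}) - {y2} \<union> {x})"
proof -
  have neq: "u1 \<noteq> u2" "l1 \<noteq> l2" using x by auto
  note tu = tight_pair_of_basis[OF X(1)] and tl = tight_pair_of_basis[OF X(2)]
  have z': "z \<in> X1 - X2"
    using z tu(2)[OF u neq(1)] tl(1)[OF l neq(2)] by blast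
  have fin: "finite X1" "finite X2" using X basis_finite by blast+
  have uniq1: "i = j" if "tight X1 i" "tight X1 j" "s \<in> H i" "s \<in> H j" "s \<notin> X1" for i j s
    using tu(2)[OF that(1,2)] that by blast
  have uniq2: "i = j" if "tight X2 i" "tight X2 j" "s \<in> H i" "s \<in> H j" "s \<notin> X2" for i j s
    using tl(2)[OF that(1,2)] that by blast
  let ?W1 = "X1 - {z} \<union> {y1}" and ?W2 = "X2 - {y1} \<union> {z}"
  have first: "symmetric_exchange \<I> (X1, X2) (?W1, ?W2)"
  proof (rule exchange_pair[OF X z' y1(1)])
    fix i assume "tight X1 i" "y1 \<in> H i"
    then have "i = u1" using uniq1 u(1) y1 by blast
    then show "z \<in> H i" using z by simp
  next
    fix i assume i: "tight X2 i" "z \<in> H i"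
    then have "i \<noteq> l2" using z by auto
    then show "y1 \<in> H i" using tl(1)[OF i(1) l(2)] y1 by blast
  qed
  have W: "is_basis \<I> ?W1" "is_basis \<I> ?W2"
    using first by (auto elim: symmetric_exchangeE symmetric_exchange.cases)
  have c1: "card (?W1 \<inter> A) + of_bool (z \<in> A) = card (X1 \<inter> A) + of_bool (y1 \<in> A)" for A
    by (rule card_Int_exchange) (use fin z' y1 in auto)
  have c2: "card (?W2 \<inter> A) + of_bool (y1 \<in> A) = card (X2 \<inter> A) + of_bool (z \<in> A)" for A
    by (rule card_Int_exchange) (use fin z' y1 in auto)
  have le: "card (X1 \<inter> H i) \<le> \<rho> i" "card (X2 \<inter> H i) \<le> \<rho> i" if "i \<in> N" for i
    using X basis_bound that by blast+
  have "x \<noteq> z" "y1 \<noteq> y2" using x z y1 y2 by auto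
  then have xy: "x \<in> ?W1 - ?W2" "y2 \<in> ?W2 - ?W1" using x y2 z' y1 by auto
  have second: "symmetric_exchange \<I> (?W1, ?W2) (?W1 - {x} \<union> {y2}, ?W2 - {y2} \<union> {x})"
  proof (rule exchange_pair[OF W xy])
    fix i assume i: "tight ?W1 i" "y2 \<in> H i"
    then have N: "i \<in> N" by (simp add: tight_def)
    show "x \<in> H i"
    proof (cases "y1 \<in> H i \<and> z \<notin> H i")
      case True
      then have "card (X1 \<inter> H i) + 1 = \<rho> i" using c1[of "H i"] i by (simp add: tight_def)
      moreover have "i \<noteq> u1" using True z by auto
      ultimately have "X1 \<subseteq> H i \<union> H u1"
        using nearly_tight_pair_covers_basis[OF X(1) N _ u(1), of y1] True y1 by blast
      then show ?thesis using x by blast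
    next
      case False
      then have "\<rho> i \<le> card (X1 \<inter> H i)"
        using c1[of "H i"] i by (auto simp: tight_def of_bool_def split: if_splits)
      then have "tight X1 i" using le(1)[OF N] N by (simp add: tight_def)
      then have "i = u2" using uniq1 u(2) y2 i(2) by blast
      then show ?thesis using x by simp
    qed
  next
    fix i assume i: "tight ?W2 i" "x \<in> H i"
    then have N: "i \<in> N" by (simp add: tight_def)
    show "y2 \<in> H i"
    proof (cases "z \<in> H i \<and> y1 \<notin> H i")
      case True
      then have "card (X2 \<inter> H i) + 1 = \<rho> i" using c2[of "H i"] i by (simp add: tight_def)
      moreover have "i \<noteq> l1" using True z by auto
      ultimately have "X2 \<subseteq> H i \<union> H l1"
        using nearly_tight_pair_covers_basis[OF X(2) N _ l(1), of x] x i(2) by blast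
      then show ?thesis using y2 by blast
    next
      case False
      then have "\<rho> i \<le> card (X2 \<inter> H i)"
        using c2[of "H i"] i by (auto simp: tight_def of_bool_def split: if_splits)
      then have "tight X2 i" using le(2)[OF N] N by (simp add: tight_def)
      then have i_eq: "i = l1" using uniq2 l(1) x i(2) by blast
      have "card (?W2 \<inter> H l1) + 1 = card (X2 \<inter> H l1)"
        using c2[of "H l1"] z y1 by simp
      then show ?thesis using i(1) le(2)[OF N] by (simp add: tight_def i_eq)
    qed
  qed
  show ?thesis
    unfolding equivalent_pairs_def using first second by (meson r_into_rtranclp rtranclp.rtrancl_into_rtrancl)
qed

text \<open>If neither kind of element existed, \<open>card_crossing_lower_bound\<close> would apply. But by the overlap
  bounds its right-hand side is at most \<open>2 * (\<rho> u1 + \<rho> u2 + \<rho> l1 + \<rho> l2) - 4 * r\<close>, which is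
  exactly its left-hand side, as overlaps of tight sets attain their bounds.\<close>

lemma detour_element:
  assumes X: "is_basis \<I> X1" "is_basis \<I> X2"
    and u: "tight X1 u1" "tight X1 u2" and l: "tight X2 l1" "tight X2 l2"
    and x1: "x1 \<in> H u1 - H u2" "x1 \<in> H l2 - H l1"
    and x2: "x2 \<in> H u2 - H u1" "x2 \<in> H l1 - H l2"
    and y1: "y1 \<in> H u1 - H u2" "y1 \<in> H l1 - H l2"
  shows "(\<exists>z. z \<in> H u1 \<inter> H u2 \<and> z \<notin> H l1 \<union> H l2) \<or> (\<exists>z. z \<in> H l1 \<inter> H l2 \<and> z \<notin> H u1 \<union> H u2)"
proof (rule ccontr)
  assume "\<not> ?thesis"
  then have sub: "H u1 \<inter> H u2 \<subseteq> H l1 \<union> H l2" "H l1 \<inter> H l2 \<subseteq> H u1 \<union> H u2" by blast+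
  have N: "u1 \<in> N" "u2 \<in> N" "l1 \<in> N" "l2 \<in> N" using u l by (auto simp: tight_def)
  have fin: "finite (H i)" if "i \<in> N" for i
    using that H_subset finite_ground finite_subset by metis
  have lt: "2 * card (H u1 \<inter> H u2) + 2 * card (H l1 \<inter> H l2)
    < card (H u1 \<inter> H l1) + card (H u1 \<inter> H l2) + card (H u2 \<inter> H l1) + card (H u2 \<inter> H l2)"
    by (rule card_crossing_lower_bound) (use fin N sub x1 in auto)
  have neq: "u1 \<noteq> u2" "l1 \<noteq> l2" "u1 \<noteq> l1" "u1 \<noteq> l2" "u2 \<noteq> l1" "u2 \<noteq> l2"
    using x1 x2 y1 by auto
  have "card (H u1 \<inter> H u2) + r = \<rho> u1 + \<rho> u2" "card (H l1 \<inter> H l2) + r = \<rho> l1 + \<rho> l2"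
    using tight_pair_of_basis(3)[OF X(1) u] tight_pair_of_basis(3)[OF X(2) l] neq by auto
  moreover have "card (H u1 \<inter> H l1) + r \<le> \<rho> u1 + \<rho> l1" "card (H u1 \<inter> H l2) + r \<le> \<rho> u1 + \<rho> l2"
    "card (H u2 \<inter> H l1) + r \<le> \<rho> u2 + \<rho> l1" "card (H u2 \<inter> H l2) + r \<le> \<rho> u2 + \<rho> l2"
    using overlap N neq by auto
  ultimately show False using lt by linarith
qed

lemma card_Diff_Int_le_if_tight:
  assumes "is_basis \<I> X" "is_basis \<I> Y" "tight X i"
  shows "card ((Y - X) \<inter> H i) \<le> card ((X - Y) \<inter> H i)"
proof -
  have fin: "finite X" "finite Y" using assms basis_finite by blast+
  have split: "card (A \<inter> C) = card (A \<inter> B \<inter> C) + card ((A - B) \<inter> C)" if "finite A" for A B C :: "'a set"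
  proof -
    have "A \<inter> C = (A \<inter> B \<inter> C) \<union> ((A - B) \<inter> C)" by blast
    moreover have "card ((A \<inter> B \<inter> C) \<union> ((A - B) \<inter> C)) = card (A \<inter> B \<inter> C) + card ((A - B) \<inter> C)"
      by (rule card_Un_disjoint) (use that in auto)
    ultimately show ?thesis by simp
  qed
  have "card (Y \<inter> H i) \<le> card (X \<inter> H i)"
    using basis_bound[OF assms(2), of i] assms(3) by (simp add: tight_def)
  then show ?thesis
    using split[OF fin(1), of "H i" Y] split[OF fin(2), of "H i" X] by (simp add: Int_commute)
qed

text \<open>A single exchange if there is one between \<open>X1 - Y1\<close> and \<open>X2 - Y2\<close>, and a detour otherwise.\<close>

lemma approach:
  assumes X: "is_basis \<I> X1" "is_basis \<I> X2" and Y: "is_basis \<I> Y1" "is_basis \<I> Y2"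
    and same: "X1 \<union> X2 = Y1 \<union> Y2" "X1 \<inter> X2 = Y1 \<inter> Y2" and ne: "X1 \<noteq> Y1"
  shows "\<exists>W1 W2. equivalent_pairs \<I> (X1, X2) (W1, W2) \<and> card (W1 - Y1) < card (X1 - Y1)"
proof -
  have D: "X1 - Y1 = Y2 - X2" "X2 - Y2 = Y1 - X1" using same by blast+
  have Dsub: "X1 - Y1 \<subseteq> X1 - X2" "X2 - Y2 \<subseteq> X2 - X1" using same by blast+
  have fin: "finite X1" "finite X2" "finite Y1" using X Y basis_finite by blast+
  have "card X1 = card Y1" using X Y basis_card by simp
  then have card_eq: "card (X1 - Y1) = card (X2 - Y2)" and neD: "X1 - Y1 \<noteq> {}"
    using D(2) fin ne card_le_sym_Diff[of X1 Y1] card_le_sym_Diff[of Y1 X1]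
      card_seteq[of Y1 X1] by auto
  show ?thesis
  proof (cases "\<exists>x\<in>X1 - Y1. \<exists>y\<in>X2 - Y2.
      (\<forall>i. tight X1 i \<longrightarrow> y \<in> H i \<longrightarrow> x \<in> H i) \<and> (\<forall>i. tight X2 i \<longrightarrow> x \<in> H i \<longrightarrow> y \<in> H i)")
    case True
    then obtain x y where xy: "x \<in> X1 - Y1" "y \<in> X2 - Y2"
      "\<And>i. tight X1 i \<Longrightarrow> y \<in> H i \<Longrightarrow> x \<in> H i" "\<And>i. tight X2 i \<Longrightarrow> x \<in> H i \<Longrightarrow> y \<in> H i"
      by blast
    have "symmetric_exchange \<I> (X1, X2) (X1 - {x} \<union> {y}, X2 - {y} \<union> {x})"
      by (rule exchange_pair[OF X]) (use xy Dsub in auto)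
    moreover have "card (X1 - {x} \<union> {y} - Y1) < card (X1 - Y1)"
      by (rule psubset_card_mono[OF finite_Diff[OF fin(1)]]) (use xy D(2) in blast)
    ultimately show ?thesis unfolding equivalent_pairs_def by blast
  next
    case False
    let ?T1 = "{i. tight X1 i}" and ?T2 = "{i. tight X2 i}"
    have le1: "card ((X2 - Y2) \<inter> H i) \<le> card ((X1 - Y1) \<inter> H i)" if "i \<in> ?T1" for i
      using card_Diff_Int_le_if_tight[OF X(1) Y(1)] that D by simp
    have le2: "card ((X1 - Y1) \<inter> H i) \<le> card ((X2 - Y2) \<inter> H i)" if "i \<in> ?T2" for i
      using card_Diff_Int_le_if_tight[OF X(2) Y(2)] that D by simp
    have disj1: "(X2 - Y2) \<inter> H i \<inter> H j = {}" if "i \<in> ?T1" "j \<in> ?T1" "i \<noteq> j" for i j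
      using tight_pair_of_basis(2)[OF X(1), of i j] that Dsub by blast
    have disj2: "(X1 - Y1) \<inter> H i \<inter> H j = {}" if "i \<in> ?T2" "j \<in> ?T2" "i \<noteq> j" for i j
      using tight_pair_of_basis(2)[OF X(2), of i j] that Dsub by blast
    have cov1: "X1 - Y1 \<subseteq> H i \<union> H j" if "i \<in> ?T1" "j \<in> ?T1" "i \<noteq> j" for i j
      using tight_pair_of_basis(1)[OF X(1), of i j] that by blast
    have cov2: "X2 - Y2 \<subseteq> H i \<union> H j" if "i \<in> ?T2" "j \<in> ?T2" "i \<noteq> j" for i j
      using tight_pair_of_basis(1)[OF X(2), of i j] that by blast
    have stuck: "(\<exists>i\<in>?T1. y \<in> H i \<and> x \<notin> H i) \<or> (\<exists>i\<in>?T2. x \<in> H i \<and> y \<notin> H i)"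
      if "x \<in> X1 - Y1" "y \<in> X2 - Y2" for x y
      using False that by blast
    obtain u1 u2 l1 l2 x1 x2 y1 y2 where
      t: "tight X1 u1" "tight X1 u2" "tight X2 l1" "tight X2 l2" and
      x1: "x1 \<in> X1 - Y1" "x1 \<in> H u1 - H u2" "x1 \<in> H l2 - H l1" and
      x2: "x2 \<in> X1 - Y1" "x2 \<in> H u2 - H u1" "x2 \<in> H l1 - H l2" and
      y1: "y1 \<in> X2 - Y2" "y1 \<in> H u1 - H u2" "y1 \<in> H l1 - H l2" and
      y2: "y2 \<in> X2 - Y2" "y2 \<in> H u2 - H u1" "y2 \<in> H l2 - H l1"
      by (rule stuck_configuration[OF finite_Diff[OF fin(1)] finite_Diff[OF fin(2)] card_eq neD
            le1 le2 disj1 disj2 cov1 cov2 stuck, unfolded mem_Collect_eq]) (assumption | rule that)+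
    from detour_element[OF X t x1(2,3) x2(2,3) y1(2,3)] show ?thesis
    proof (elim disjE exE conjE)
      fix z assume z: "z \<in> H u1 \<inter> H u2" "z \<notin> H l1 \<union> H l2"
      have "equivalent_pairs \<I> (X1, X2)
         ((X1 - {z} \<union> {y1}) - {x2} \<union> {y2}, (X2 - {y1} \<union> {z}) - {y2} \<union> {x2})"
        by (rule detour[OF X t]) (use x2 y1 y2 z Dsub in auto)
      moreover have "card ((X1 - {z} \<union> {y1}) - {x2} \<union> {y2} - Y1) < card (X1 - Y1)"
        by (rule psubset_card_mono[OF finite_Diff[OF fin(1)]]) (use x2 y1 y2 D(2) in blast)
      ultimately show ?thesis by blast
    next
      fix z assume z: "z \<in> H l1 \<inter> H l2" "z \<notin> H u1 \<union> H u2"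
      \<comment> \<open>The mirror image of the previous case: interchanging the two bases turns \<open>(u1, u2, l1, l2)\<close>
        into \<open>(l1, l2, u2, u1)\<close> and \<open>(x2, y1, y2)\<close> into \<open>(y2, x2, x1)\<close>. Here \<open>z\<close> may be a new element
        of \<open>W1 - Y1\<close>, but both \<open>x1\<close> and \<open>x2\<close> have left.\<close>
      have "equivalent_pairs \<I> (X2, X1)
         ((X2 - {z} \<union> {x2}) - {y2} \<union> {x1}, (X1 - {x2} \<union> {z}) - {x1} \<union> {y2})"
        by (rule detour[OF X(2,1) t(3,4,2,1)]) (use x2 x1 y2 z Dsub in auto)
      from equivalent_pairs_swap[OF this]
      have "equivalent_pairs \<I> (X1, X2)
         ((X1 - {x2} \<union> {z}) - {x1} \<union> {y2}, (X2 - {z} \<union> {x2}) - {y2} \<union> {x1})" by simp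
      moreover have "card ((X1 - {x2} \<union> {z}) - {x1} \<union> {y2} - Y1) < card (X1 - Y1)"
      proof -
        let ?C = "X1 - Y1 - {x1, x2}"
        have fC: "finite ?C" using fin by blast
        have "y2 \<in> Y1" using y2(1) D(2) by blast
        then have "(X1 - {x2} \<union> {z}) - {x1} \<union> {y2} - Y1 \<subseteq> insert z ?C" by blast
        then have "card ((X1 - {x2} \<union> {z}) - {x1} \<union> {y2} - Y1) \<le> card (insert z ?C)"
          using fC by (intro card_mono) simp_all
        also have "card (insert z ?C) \<le> Suc (card ?C)"
          using fC by (simp add: card_insert_if)
        also have "Suc (card ?C) < card (X1 - Y1)"
        proof -
          have "x1 \<noteq> x2" using x1 x2 by auto
          then have "card {x1, x2} = 2" by simp
          moreover have sub: "{x1, x2} \<subseteq> X1 - Y1" using x1 x2 by simp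
          ultimately show ?thesis
            using card_Diff_subset[OF _ sub] card_mono[OF _ sub] fin by simp
        qed
        finally show ?thesis .
      qed
      ultimately show ?thesis by blast
    qed
  qed
qed

lemma equivalent_if_same_union_and_intersection:
  assumes "is_basis \<I> X1" "is_basis \<I> X2" "is_basis \<I> Y1" "is_basis \<I> Y2"
    and "X1 \<union> X2 = Y1 \<union> Y2" "X1 \<inter> X2 = Y1 \<inter> Y2"
  shows "equivalent_pairs \<I> (X1, X2) (Y1, Y2)"
  using assms
proof (induction "card (X1 - Y1)" arbitrary: X1 X2 rule: less_induct)
  case less
  show ?case
  proof (cases "X1 = Y1")
    case True
    then have "X2 = Y2" using less.prems(5,6) by blast
    then show ?thesis using True by (simp add: equivalent_pairs_def)
  next
    case False
    obtain W1 W2 where W: "equivalent_pairs \<I> (X1, X2) (W1, W2)" "card (W1 - Y1) < card (X1 - Y1)"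
      using approach[OF less.prems False] by blast
    have "equivalent_pairs \<I> (W1, W2) (Y1, Y2)"
      using less.hyps[OF W(2)] equivalent_pairs_bases[OF W(1)] less.prems
        equivalent_pairs_same_union_and_intersection[OF W(1)] by simp
    then show ?thesis using W(1) unfolding equivalent_pairs_def by (rule rtranclp_trans[rotated])
  qed
qed

end

lemma elementary_split_equivalent_if_same_union_and_intersection:
  assumes "elementary_split_matroid E \<I>"
    and "is_basis \<I> X1" "is_basis \<I> X2" "is_basis \<I> Y1" "is_basis \<I> Y2"
    and "X1 \<union> X2 = Y1 \<union> Y2" "X1 \<inter> X2 = Y1 \<inter> Y2"
  shows "equivalent_pairs \<I> (X1, X2) (Y1, Y2)"
proof -
  obtain r q :: nat and \<rho> :: "nat \<Rightarrow> nat" and H :: "nat \<Rightarrow> 'a set" where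
    fin: "finite E" and r: "r \<le> card E" and H: "\<And>i. i \<in> {1..q} \<Longrightarrow> H i \<subseteq> E" and
    overlap: "\<And>i j. i \<in> {1..q} \<Longrightarrow> j \<in> {1..q} \<Longrightarrow> i < j \<Longrightarrow>
       int (card (H i \<inter> H j)) \<le> int (\<rho> i) + int (\<rho> j) - int r" and
    outside: "\<And>i. i \<in> {1..q} \<Longrightarrow> r \<le> card (E - H i) + \<rho> i" and
    I: "\<I> = {X. X \<subseteq> E \<and> card X \<le> r \<and> (\<forall>i\<in>{1..q}. card (X \<inter> H i) \<le> \<rho> i)}"
    using assms(1) unfolding elementary_split_matroid_def by blast
  have overlap': "card (H i \<inter> H j) + r \<le> \<rho> i + \<rho> j" if "i \<in> {1..q}" "j \<in> {1..q}" "i \<noteq> j" for i j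
  proof (cases "i < j")
    case True
    then show ?thesis using overlap[OF that(1,2)] by linarith
  next
    case False
    then show ?thesis using overlap[OF that(2,1)] that(3) by (simp add: Int_commute)
  qed
  interpret elementary_split_presentation E \<I> r "{1..q}" \<rho> H
    by unfold_locales (use fin r H overlap' outside I in auto)
  show ?thesis using assms(2-) by (rule equivalent_if_same_union_and_intersection)
qed

section \<open>Direct sums\<close>

text \<open>The form in which direct summands are used: independence can be tested separately on \<open>A\<close> and
  on its complement.\<close>

lemma direct_summand_iff:
  "direct_summand E \<I> A \<longleftrightarrow>
    A \<subseteq> E \<and> (\<forall>X. X \<in> \<I> \<longleftrightarrow> X \<subseteq> E \<and> X \<inter> A \<in> \<I> \<and> X - A \<in> \<I>)"
proof (cases "A \<subseteq> E")
  case True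
  have "X \<in> direct_sum (restrict_indep \<I> A) (restrict_indep \<I> (E - A)) \<longleftrightarrow>
     X \<subseteq> E \<and> X \<inter> A \<in> \<I> \<and> X - A \<in> \<I>" for X
  proof
    assume "X \<in> direct_sum (restrict_indep \<I> A) (restrict_indep \<I> (E - A))"
    then obtain P Q where X: "X = P \<union> Q" and PQ: "P \<in> \<I>" "P \<subseteq> A" "Q \<in> \<I>" "Q \<subseteq> E - A"
      by (auto simp: direct_sum_def restrict_indep_def)
    have "X \<inter> A = P" "X - A = Q" "X \<subseteq> E" unfolding X using PQ(2,4) True by blast+
    then show "X \<subseteq> E \<and> X \<inter> A \<in> \<I> \<and> X - A \<in> \<I>" using PQ(1,3) by simp
  next
    assume "X \<subseteq> E \<and> X \<inter> A \<in> \<I> \<and> X - A \<in> \<I>"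
    moreover have "X = X \<inter> A \<union> (X - A)" by blast
    ultimately show "X \<in> direct_sum (restrict_indep \<I> A) (restrict_indep \<I> (E - A))"
      unfolding direct_sum_def restrict_indep_def by blast
  qed
  then show ?thesis using True by (simp add: direct_summand_def set_eq_iff)
qed (simp add: direct_summand_def)

lemma direct_summandD:
  assumes "direct_summand E \<I> A"
  shows direct_summand_subset: "A \<subseteq> E"
    and direct_summand_indep_iff: "X \<in> \<I> \<longleftrightarrow> X \<subseteq> E \<and> X \<inter> A \<in> \<I> \<and> X - A \<in> \<I>"
proof -
  note * = iffD1[OF direct_summand_iff assms]
  show "A \<subseteq> E" using * by (rule conjunct1)
  show "X \<in> \<I> \<longleftrightarrow> X \<subseteq> E \<and> X \<inter> A \<in> \<I> \<and> X - A \<in> \<I>"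
    using conjunct2[OF *] by (rule spec)
qed

lemma direct_summand_complement:
  assumes "direct_summand E \<I> A"
  shows "direct_summand E \<I> (E - A)"
proof -
  have "X \<in> \<I> \<longleftrightarrow> X \<subseteq> E \<and> X \<inter> (E - A) \<in> \<I> \<and> X - (E - A) \<in> \<I>" for X
  proof (cases "X \<subseteq> E")
    case True
    then have "X \<inter> (E - A) = X - A" "X - (E - A) = X \<inter> A" by blast+
    then show ?thesis using direct_summand_indep_iff[OF assms, of X]
      by (simp only:) (rule conj_cong[OF refl conj_commute])
  next
    case False
    then show ?thesis using direct_summand_indep_iff[OF assms, of X] by blast
  qed
  then show ?thesis unfolding direct_summand_iff by (intro conjI allI Diff_subset)
qed

lemma restrict_restrict: "C \<subseteq> A \<Longrightarrow> restrict_indep (restrict_indep \<I> A) C = restrict_indep \<I> C"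
  by (auto simp: restrict_indep_def)

lemma direct_summand_trans:
  assumes A: "direct_summand E \<I> A" and C: "direct_summand A (restrict_indep \<I> A) C"
  shows "direct_summand E \<I> C"
proof -
  have A': "A \<subseteq> E" "\<And>X. X \<in> \<I> \<longleftrightarrow> X \<subseteq> E \<and> X \<inter> A \<in> \<I> \<and> X - A \<in> \<I>"
    using direct_summandD[OF A] .
  have CA: "C \<subseteq> A" using C by (rule direct_summand_subset)
  have C': "X \<in> \<I> \<longleftrightarrow> X \<inter> C \<in> \<I> \<and> X - C \<in> \<I>" if "X \<subseteq> A" for X
  proof -
    have "X \<inter> C \<subseteq> A" "X - C \<subseteq> A" using that by blast+
    then show ?thesis
      using direct_summand_indep_iff[OF C, of X] that by (simp add: restrict_indep_def)
  qed
  have "X \<in> \<I> \<longleftrightarrow> X \<subseteq> E \<and> X \<inter> C \<in> \<I> \<and> X - C \<in> \<I>" for X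
  proof -
    have eq: "X \<inter> A \<inter> C = X \<inter> C" "(X - C) \<inter> A = X \<inter> A - C" "X - C - A = X - A"
      using CA by blast+
    have 1: "X \<inter> A \<in> \<I> \<longleftrightarrow> X \<inter> C \<in> \<I> \<and> X \<inter> A - C \<in> \<I>"
      using C'[of "X \<inter> A"] eq by simp
    have 2: "X \<subseteq> E \<Longrightarrow> X - C \<in> \<I> \<longleftrightarrow> X \<inter> A - C \<in> \<I> \<and> X - A \<in> \<I>"
      using A'(2)[of "X - C"] unfolding eq by blast
    show ?thesis using 1 2 A'(2)[of X] by blast
  qed
  moreover have "C \<subseteq> E" using A'(1) CA by blast
  ultimately show ?thesis unfolding direct_summand_iff by blast
qed

lemma matroid_components_of_summand:
  assumes "direct_summand E \<I> A"
  shows "matroid_components A (restrict_indep \<I> A) \<subseteq> matroid_components E \<I>"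
proof
  fix C assume C: "C \<in> matroid_components A (restrict_indep \<I> A)"
  then have "C \<subseteq> A" by (auto simp: matroid_components_def direct_summand_def)
  then show "C \<in> matroid_components E \<I>"
    using C direct_summand_trans[OF assms] by (simp add: matroid_components_def restrict_restrict)
qed

lemma basis_direct_sum_iff:
  assumes "direct_summand E \<I> A"
  shows "is_basis \<I> X \<longleftrightarrow> X \<subseteq> E \<and>
    is_basis (restrict_indep \<I> A) (X \<inter> A) \<and> is_basis (restrict_indep \<I> (E - A)) (X - A)"
proof -
  have A: "A \<subseteq> E" and indep: "\<And>X. X \<in> \<I> \<longleftrightarrow> X \<subseteq> E \<and> X \<inter> A \<in> \<I> \<and> X - A \<in> \<I>"
    using direct_summandD[OF assms] .
  have join: "P \<union> Q \<in> \<I>" if "P \<in> \<I>" "P \<subseteq> A" "Q \<in> \<I>" "Q \<subseteq> E - A" for P Q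
  proof -
    have eq: "(P \<union> Q) \<inter> A = P" "(P \<union> Q) - A = Q" using that(2,4) by blast+
    have "P \<union> Q \<subseteq> E" using that(2,4) A by blast
    then show ?thesis unfolding indep[of "P \<union> Q"] eq using that(1,3) by blast
  qed
  show ?thesis
  proof
    assume X: "is_basis \<I> X"
    then have XI: "X \<in> \<I>" and max: "\<And>Z. Z \<in> \<I> \<Longrightarrow> X \<subseteq> Z \<Longrightarrow> Z = X"
      by (auto simp: is_basis_def)
    have parts: "X \<subseteq> E" "X \<inter> A \<in> \<I>" "X - A \<in> \<I>" using XI[unfolded indep[of X]] by blast+
    have "Z = X \<inter> A" if Z: "Z \<in> \<I>" "Z \<subseteq> A" "X \<inter> A \<subseteq> Z" for Z
    proof -
      have "Z \<union> (X - A) = X"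
        by (rule max[OF join[OF Z(1,2) parts(3)]]) (use parts Z in auto)
      then show ?thesis using Z by blast
    qed
    moreover have "Z = X - A" if Z: "Z \<in> \<I>" "Z \<subseteq> E - A" "X - A \<subseteq> Z" for Z
    proof -
      have "X \<inter> A \<union> Z = X"
        by (rule max[OF join[OF parts(2) _ Z(1,2)]]) (use parts Z in auto)
      then show ?thesis using Z by blast
    qed
    ultimately show "X \<subseteq> E \<and> is_basis (restrict_indep \<I> A) (X \<inter> A) \<and>
        is_basis (restrict_indep \<I> (E - A)) (X - A)"
      using parts unfolding is_basis_def restrict_indep_def by auto
  next
    assume X: "X \<subseteq> E \<and> is_basis (restrict_indep \<I> A) (X \<inter> A) \<and>
        is_basis (restrict_indep \<I> (E - A)) (X - A)"
    then have parts: "X \<inter> A \<in> \<I>" "X - A \<in> \<I>"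
      and max: "\<And>Z. Z \<in> \<I> \<Longrightarrow> Z \<subseteq> A \<Longrightarrow> X \<inter> A \<subseteq> Z \<Longrightarrow> Z = X \<inter> A"
        "\<And>Z. Z \<in> \<I> \<Longrightarrow> Z \<subseteq> E - A \<Longrightarrow> X - A \<subseteq> Z \<Longrightarrow> Z = X - A"
      by (auto simp: is_basis_def restrict_indep_def)
    have "Z = X" if Z: "Z \<in> \<I>" "X \<subseteq> Z" for Z
    proof -
      have ZE: "Z \<subseteq> E" "Z \<inter> A \<in> \<I>" "Z - A \<in> \<I>" using Z(1)[unfolded indep[of Z]] by blast+
      have "Z \<inter> A = X \<inter> A" by (rule max(1)) (use ZE Z(2) in blast)+
      moreover have "Z - A = X - A" by (rule max(2)) (use ZE Z(2) in blast)+
      ultimately show ?thesis by blast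
    qed
    moreover have "X \<in> \<I>" unfolding indep[of X] using X parts by simp
    ultimately show "is_basis \<I> X" by (simp add: is_basis_def)
  qed
qed

lemma equivalent_pairs_direct_sum:
  assumes A: "direct_summand E \<I> A" and equiv: "equivalent_pairs (restrict_indep \<I> A) P Q"
    and R: "is_basis (restrict_indep \<I> (E - A)) R1" "is_basis (restrict_indep \<I> (E - A)) R2"
  shows "equivalent_pairs \<I> (fst P \<union> R1, snd P \<union> R2) (fst Q \<union> R1, snd Q \<union> R2)"
  using equiv unfolding equivalent_pairs_def
proof (induction rule: rtranclp_induct)
  case (step Q W)
  have RA: "R1 \<subseteq> E - A" "R2 \<subseteq> E - A" using R by (auto simp: is_basis_def restrict_indep_def)
  have basis: "is_basis \<I> (X \<union> R')"
    if "is_basis (restrict_indep \<I> A) X" "is_basis (restrict_indep \<I> (E - A)) R'" for X R'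
  proof -
    have "X \<subseteq> A" "R' \<subseteq> E - A" using that by (auto simp: is_basis_def restrict_indep_def)
    moreover from this have "(X \<union> R') \<inter> A = X" "X \<union> R' - A = R'" by blast+
    moreover have "A \<subseteq> E" using A by (simp add: direct_summand_def)
    ultimately show ?thesis using that basis_direct_sum_iff[OF A, of "X \<union> R'"] by auto
  qed
  obtain Q1 Q2 where Q: "Q = (Q1, Q2)" by (cases Q)
  from step.hyps(2) obtain e f where
    Qb: "is_basis (restrict_indep \<I> A) Q1" "is_basis (restrict_indep \<I> A) Q2" and
    ef: "e \<in> Q1 - Q2" "f \<in> Q2 - Q1" and
    W: "is_basis (restrict_indep \<I> A) (Q1 - {e} \<union> {f})" "is_basis (restrict_indep \<I> A) (Q2 - {f} \<union> {e})"
      "W = (Q1 - {e} \<union> {f}, Q2 - {f} \<union> {e})"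
    unfolding Q by (rule symmetric_exchangeE)
  have QA: "Q1 \<subseteq> A" "Q2 \<subseteq> A" using Qb by (auto simp: is_basis_def restrict_indep_def)
  have eq: "fst W \<union> R1 = Q1 \<union> R1 - {e} \<union> {f}" "snd W \<union> R2 = Q2 \<union> R2 - {f} \<union> {e}"
    using W(3) QA RA ef by auto
  have "symmetric_exchange \<I> (Q1 \<union> R1, Q2 \<union> R2) (fst W \<union> R1, snd W \<union> R2)"
    unfolding eq
    by (rule symmetric_exchangeI)
      (use basis[OF Qb(1) R(1)] basis[OF Qb(2) R(2)] basis[OF W(1) R(1)] basis[OF W(2) R(2)]
        eq W(3) ef QA RA in auto)
  then show ?case using step.IH unfolding Q by simp
qed simp

text \<open>Induction on the size of the ground set, splitting off any proper direct summand: this avoids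
  showing that the components partition the ground set. The first bases are moved into place on
  \<open>A\<close> while the rest of each basis stays fixed, and then on \<open>E - A\<close>.\<close>

lemma equivalent_if_components_elementary_split:
  assumes "finite E" and "{} \<in> \<I>" and "\<And>X. X \<in> \<I> \<Longrightarrow> X \<subseteq> E"
    and "\<And>A. A \<in> matroid_components E \<I> \<Longrightarrow> elementary_split_matroid A (restrict_indep \<I> A)"
    and "is_basis \<I> X1" "is_basis \<I> X2" "is_basis \<I> Y1" "is_basis \<I> Y2"
    and "X1 \<union> X2 = Y1 \<union> Y2" "X1 \<inter> X2 = Y1 \<inter> Y2"
  shows "equivalent_pairs \<I> (X1, X2) (Y1, Y2)"
  using assms
proof (induction "card E" arbitrary: E \<I> X1 X2 Y1 Y2 rule: less_induct)
  case less
  note sub = less.prems(3)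
  have whole: "restrict_indep \<I> E = \<I>" using sub by (auto simp: restrict_indep_def)
  consider "E = {}" | "E \<noteq> {}" "connected_matroid E \<I>" |
    A where "direct_summand E \<I> A" "A \<noteq> {}" "A \<noteq> E"
    unfolding connected_matroid_def by blast
  then show ?case
  proof cases
    case 1
    then have "X1 = {}" "X2 = {}" "Y1 = {}" "Y2 = {}"
      using sub less.prems(5-8) unfolding is_basis_def by auto
    then show ?thesis by (simp add: equivalent_pairs_def)
  next
    case 2
    have "X \<in> \<I> \<longleftrightarrow> X \<subseteq> E \<and> X \<inter> E \<in> \<I> \<and> X - E \<in> \<I>" for X
    proof (cases "X \<subseteq> E")
      case True
      then have eq: "X \<inter> E = X" "X - E = {}" by blast+
      show ?thesis unfolding eq using True less.prems(2) by simp
    qed (use sub in blast)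
    then have "direct_summand E \<I> E" unfolding direct_summand_iff by blast
    then have "E \<in> matroid_components E \<I>"
      using 2 whole by (simp add: matroid_components_def)
    then have "elementary_split_matroid E \<I>" using less.prems(4) whole by metis
    then show ?thesis
      using elementary_split_equivalent_if_same_union_and_intersection less.prems(5-) by metis
  next
    case 3
    note A = 3(1)
    have B: "direct_summand E \<I> (E - A)" using A by (rule direct_summand_complement)
    have AE: "A \<subseteq> E" using A by (simp add: direct_summand_def)
    then have BB: "E - (E - A) = A" by blast
    note bases = less.prems(5-8)[unfolded basis_direct_sum_iff[OF A]]
    have small: "card A < card E" "card (E - A) < card E"
      using 3 AE less.prems(1) by (auto intro!: psubset_card_mono)
    have *: "equivalent_pairs (restrict_indep \<I> C) (P1, P2) (Q1, Q2)"
      if C: "direct_summand E \<I> C" "card C < card E"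
       and P: "is_basis (restrict_indep \<I> C) P1" "is_basis (restrict_indep \<I> C) P2"
         "is_basis (restrict_indep \<I> C) Q1" "is_basis (restrict_indep \<I> C) Q2"
         "P1 \<union> P2 = Q1 \<union> Q2" "P1 \<inter> P2 = Q1 \<inter> Q2" for C P1 P2 Q1 Q2
    proof (rule less.hyps[OF C(2)])
      have CE: "C \<subseteq> E" using C by (simp add: direct_summand_def)
      show "finite C" using CE less.prems(1) finite_subset by blast
      show "{} \<in> restrict_indep \<I> C" using less.prems(2) by (simp add: restrict_indep_def)
      show "X \<subseteq> C" if "X \<in> restrict_indep \<I> C" for X using that by (simp add: restrict_indep_def)
      fix K assume K: "K \<in> matroid_components C (restrict_indep \<I> C)"
      then have "K \<subseteq> C" by (auto simp: matroid_components_def direct_summand_def)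
      then show "elementary_split_matroid K (restrict_indep (restrict_indep \<I> C) K)"
        using less.prems(4) matroid_components_of_summand[OF C(1)] K by (auto simp: restrict_restrict)
    qed (use P in auto)
    have parts: "Z \<inter> A \<union> (Z - A) = Z" "Z - A \<union> Z \<inter> A = Z" for Z by blast+
    have "equivalent_pairs (restrict_indep \<I> A) (X1 \<inter> A, X2 \<inter> A) (Y1 \<inter> A, Y2 \<inter> A)"
      by (rule *[OF A small(1)]) (use bases less.prems(9,10) in auto)
    from equivalent_pairs_direct_sum[OF A this, of "X1 - A" "X2 - A"]
    have 1: "equivalent_pairs \<I> (X1, X2) (Y1 \<inter> A \<union> (X1 - A), Y2 \<inter> A \<union> (X2 - A))"
      using bases by (simp add: parts)
    have "equivalent_pairs (restrict_indep \<I> (E - A)) (X1 - A, X2 - A) (Y1 - A, Y2 - A)"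
      by (rule *[OF B small(2)]) (use bases less.prems(9,10) in auto)
    from equivalent_pairs_direct_sum[OF B this, of "Y1 \<inter> A" "Y2 \<inter> A"]
    have 2: "equivalent_pairs \<I> (Y1 \<inter> A \<union> (X1 - A), Y2 \<inter> A \<union> (X2 - A)) (Y1, Y2)"
      using bases by (simp add: parts BB Un_commute)
    show ?thesis using 1 2 unfolding equivalent_pairs_def by (rule rtranclp_trans)
  qed
qed

lemma uniform_imp_elementary_split:
  assumes "uniform_matroid E \<I>"
  shows "elementary_split_matroid E \<I>"
proof -
  obtain k where "finite E" "k \<le> card E" "\<I> = {X. X \<subseteq> E \<and> card X \<le> k}"
    using assms unfolding uniform_matroid_def by blast
  then show ?thesis
    unfolding elementary_split_matroid_def
    by (intro conjI exI[of _ k] exI[of _ 0] exI[of _ "\<lambda>_. 0"] exI[of _ "\<lambda>_. {}"]) auto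
qed

theorem corollary15:
  fixes S :: "'a set" and \<I> :: "'a set set" and X1 X2 Y1 Y2 :: "'a set"
  assumes "split_matroid S \<I>"
    and "is_basis \<I> X1" and "is_basis \<I> X2"
    and "is_basis \<I> Y1" and "is_basis \<I> Y2"
  shows "equivalent_pairs \<I> (X1, X2) (Y1, Y2) \<longleftrightarrow> compatible_pairs S (X1, X2) (Y1, Y2)"
proof -
  interpret matroid S \<I> using assms(1) by (simp add: split_matroid_def)
  have "X1 \<subseteq> S" "X2 \<subseteq> S" "Y1 \<subseteq> S" "Y2 \<subseteq> S"
    using assms(2-) indep_subset_ground by (auto simp: is_basis_def)
  note compat = compatible_pairs_iff_same_union_and_intersection[OF this]
  have "elementary_split_matroid A (restrict_indep \<I> A)" if "A \<in> matroid_components S \<I>" for A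
    using assms(1) that uniform_imp_elementary_split unfolding split_matroid_def by blast
  then have "equivalent_pairs \<I> (X1, X2) (Y1, Y2)"
    if "X1 \<union> X2 = Y1 \<union> Y2" "X1 \<inter> X2 = Y1 \<inter> Y2"
    using equivalent_if_components_elementary_split[OF finite_ground indep_empty indep_subset_ground]
      assms(2-) that by blast
  then show ?thesis
    unfolding compat using equivalent_pairs_same_union_and_intersection by fastforce
qed

end
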